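(* Let $Y=Y_1+\dots+Y_n$, where $Y_1,\dots,Y_n$ are independent zero-mean random variables such that, for some positive real numbers $\sigma_1,\dots,\sigma_n$, $$\mathsf{E}e^{\lambda Y_i}\le e^{\lambda^2\sigma_i^2/2}\quad\text{for all } i\in\{1,\dots,n\}\text{ and all real }\lambda\ge0 .$$ Let $\sigma:=\sqrt{\sigma_1^2+\dots+\sigma_n^2}$. Then for all real $y>0$, with $t:=y/\sigma$, $\mu_t:=e^{t^2/2}$ and $v_t:=e^{t^2}$, $$\mathsf{P}(Y\ge y)\le p_{\mu_t,v_t}=\frac{\mu_t-z_{\mu_t,v_t}}{v_t-z_{\mu_t,v_t}}<\frac{\mu_t}{v_t}=e^{-t^2/2}.$$
   Context: For real $\mu>1$ and $v\in(\mu,\infty)$, $z_{\mu,v}$ denotes the only root $z\in(0,1)$ of the equation $(v-\mu)\ln z+(\mu-z)\ln v=0$ (there is exactly one such root), and $p_{\mu,v}:=\dfrac{\mu-z_{\mu,v}}{v-z_{\mu,v}}$. $\mathsf{P}$ and $\mathsf{E}$ denote probability and expectation. *)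

theory Defs
  imports "HOL-Probability.Probability"
begin

definition zroot :: "real \<Rightarrow> real \<Rightarrow> real" where
  "zroot \<mu> v = (THE z. 0 < z \<and> z < 1 \<and> (v - \<mu>) * ln z + (\<mu> - z) * ln v = 0)"

definition pbound :: "real \<Rightarrow> real \<Rightarrow> real" where
  "pbound \<mu> v = (\<mu> - zroot \<mu> v) / (v - zroot \<mu> v)"

(* The description in zroot is proper for 1 < \<mu> < v.  Uniqueness: v is always a further
   root, and three roots would give two distinct critical points. *)
lemma zroot_ex1:
  fixes \<mu> v :: real
  assumes "1 < \<mu>" "\<mu> < v"
  shows "\<exists>!z. 0 < z \<and> z < 1 \<and> (v - \<mu>) * ln z + (\<mu> - z) * ln v = 0"
proof -
  define f where "f = (\<lambda>z. (v - \<mu>) * ln z + (\<mu> - z) * ln v)"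
  have lnv: "ln v > 0" using assms by simp
  have der: "(f has_real_derivative ((v - \<mu>) / z - ln v)) (at z)" if "z > 0" for z
    unfolding f_def using that by (auto intro!: derivative_eq_intros simp: field_simps)
  have cont: "continuous_on {a..b} f" if "a > 0" for a b
    using that der by (intro DERIV_continuous_on[where D = "\<lambda>z. (v - \<mu>) / z - ln v"])
      (auto intro: has_field_derivative_at_within)
  have fv: "f v = 0" by (simp add: f_def algebra_simps)
  have crit: "\<exists>c. a < c \<and> c < b \<and> (v - \<mu>) / c = ln v"
    if "0 < a" "a < b" "f a = 0" "f b = 0" for a b
  proof -
    have "\<exists>c. a < c \<and> c < b \<and> f b - f a = (b - a) * ((v - \<mu>) / c - ln v)"
      using that by (intro MVT2) (auto intro: der)
    then show ?thesis using that by auto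
  qed
  have uniq: "False" if ab: "0 < a" "a < b" "b < 1" "f a = 0" "f b = 0" for a b
  proof -
    have "0 < b" "b < v" using ab assms by auto
    obtain c where c: "a < c" "c < b" "(v - \<mu>) / c = ln v" using crit[of a b] ab by blast
    obtain d where d: "b < d" "d < v" "(v - \<mu>) / d = ln v"
      using crit[of b v] \<open>0 < b\<close> \<open>b < v\<close> ab fv by blast
    have "v - \<mu> = ln v * c" "v - \<mu> = ln v * d"
      using c d ab by (auto simp: divide_eq_eq)
    then have "c = d" using lnv by simp
    then show False using c d by simp
  qed
  define z0 where "z0 = exp (- (\<mu> * ln v / (v - \<mu>)))"
  have "0 < \<mu> * ln v / (v - \<mu>)"
    using assms lnv by (intro divide_pos_pos mult_pos_pos) auto
  then have z0: "0 < z0" "z0 < 1" unfolding z0_def by simp_all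
  have "f z0 = - z0 * ln v"
  proof -
    have "ln z0 = - (\<mu> * ln v / (v - \<mu>))" unfolding z0_def by simp
    then have "(v - \<mu>) * ln z0 = - (\<mu> * ln v)" using assms by simp
    then show ?thesis unfolding f_def by (simp add: algebra_simps)
  qed
  then have f0: "f z0 < 0" using z0 lnv by simp
  have f1: "f 1 > 0" unfolding f_def using assms lnv by simp
  obtain z where z: "z0 \<le> z" "z \<le> 1" "f z = 0"
    using IVT'[of f z0 0 1] f0 f1 z0 cont[of z0 1] by auto
  have zb: "0 < z" "z < 1" using z z0 f1 by (auto simp: order.strict_iff_order)
  have "\<exists>!z. 0 < z \<and> z < 1 \<and> f z = 0"
  proof (rule ex1I[of _ z])
    show "0 < z \<and> z < 1 \<and> f z = 0" using z zb by simp
    show "w = z" if "0 < w \<and> w < 1 \<and> f w = 0" for w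
      using that z zb uniq[of w z] uniq[of z w] by (cases w z rule: linorder_cases) auto
  qed
  then show ?thesis unfolding f_def .
qed

end

theory Submission
  imports Defs
begin

text \<open>
  With \<open>\<lambda> = t / \<sigma>\<close>, the variable \<open>X = exp (\<lambda> Y)\<close> satisfies \<open>E X \<le> \<mu>\<close> and, since \<open>Y\<close> is centred,
  \<open>E (ln X) = 0\<close>; the event in question is \<open>X \<ge> v\<close>. The extremal law is carried by \<open>{z, v}\<close>, so
  Markov's inequality is applied to \<open>g X\<close> with \<open>g x = x / z - 1 - ln (x / z)\<close>, which is nonnegative,
  increasing on \<open>[z, \<infinity>)\<close>, and vanishes at \<open>z\<close>.
\<close>

lemma zroot_props:
  assumes "1 < \<mu>" "\<mu> < v"
  shows "0 < zroot \<mu> v" "zroot \<mu> v < 1"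
    and "(v - \<mu>) * ln (zroot \<mu> v) + (\<mu> - zroot \<mu> v) * ln v = 0"
  using theI'[OF zroot_ex1[OF assms]] unfolding zroot_def by simp_all

text \<open>Subtracting the same positive number from the numerator and denominator of a fraction
  below 1 makes it smaller.\<close>

lemma pbound_less_ratio:
  assumes "1 < \<mu>" "\<mu> < v"
  shows "pbound \<mu> v < \<mu> / v"
  using zroot_props(1,2)[OF assms] assms unfolding pbound_def
  by (simp add: divide_less_eq less_divide_eq field_simps)

text \<open>The increment of \<open>ln\<close> is at most \<open>b / a - 1 = (b - a) / a\<close>,
  hence at most \<open>b - a\<close> because \<open>a\<close> is at least 1. This makes the Markov
  test function increasing to the right of its zero.\<close>

lemma minus_one_minus_ln_mono:
  fixes a b :: real
  assumes "1 \<le> a" "a \<le> b"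
  shows "a - 1 - ln a \<le> b - 1 - ln b"
proof -
  have "ln b - ln a = ln (b / a)" using assms by (simp add: ln_div)
  also have "\<dots> \<le> b / a - 1" using assms by (intro ln_le_minus_one) simp
  also have "\<dots> = (b - a) / a" using assms by (simp add: field_simps)
  also have "\<dots> \<le> b - a" using assms by (simp add: divide_le_eq mult_le_cancel_left1)
  finally show ?thesis by simp
qed

text \<open>The bound is attained when \<open>exp W\<close> takes the value \<open>v\<close> with
  probability \<open>pbound \<mu> v\<close> and the value \<open>zroot \<mu> v\<close> otherwise:
  this choice of weight makes the mean \<open>\<mu>\<close>, and the equation defining
  \<open>zroot\<close> makes the mean logarithm 0.\<close>

lemma (in prob_space) prob_exp_ge_le_pbound:
  fixes W :: "'a \<Rightarrow> real"
  assumes \<mu>: "1 < \<mu>" "\<mu> < v"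
    and W: "integrable M W" "expectation W = 0"
    and expW: "integrable M (\<lambda>\<omega>. exp (W \<omega>))" "expectation (\<lambda>\<omega>. exp (W \<omega>)) \<le> \<mu>"
  shows "prob {\<omega> \<in> space M. exp (W \<omega>) \<ge> v} \<le> pbound \<mu> v"
proof -
  define z where "z = zroot \<mu> v"
  note z = zroot_props[OF \<mu>, folded z_def]
  have vz: "v / z > 1" using z \<mu> by (simp add: field_simps)
  \<comment> \<open>The test function is written in the logarithmic variable \<open>w\<close>, so
    that its linear term integrates by \<open>expectation W = 0\<close>. \<open>K\<close> is its
    value at \<open>ln v\<close>, the threshold for Markov's inequality.\<close>
  define g where "g = (\<lambda>w. exp w / z - 1 - (w - ln z))"
  define K where "K = v / z - 1 - ln (v / z)"
  have g_alt: "g w = exp w / z - 1 - ln (exp w / z)" for w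
    unfolding g_def using z by (simp add: ln_div)
  have g_nonneg: "0 \<le> g w" for w
    using ln_le_minus_one[of "exp w / z"] z unfolding g_alt by simp
  have K_pos: "K > 0"
    unfolding K_def using ln_less_self[of "v / z"] vz ln_eq_minus_one[of "v / z"]
      ln_le_minus_one[of "v / z"] by fastforce
  have g_ge: "K \<le> g w" if "v \<le> exp w" for w
    unfolding K_def g_alt using that vz z by (intro minus_one_minus_ln_mono divide_right_mono) auto
  have g_int: "integrable M (\<lambda>\<omega>. g (W \<omega>))"
    unfolding g_def using W expW by simp
  have "expectation (\<lambda>\<omega>. g (W \<omega>)) = expectation (\<lambda>\<omega>. exp (W \<omega>)) / z - 1 + ln z"
    unfolding g_def using W expW by (simp add: prob_space)
  also have "\<dots> \<le> \<mu> / z - 1 + ln z"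
    using expW z by (simp add: divide_right_mono)
  \<comment> \<open>Both sides are the mean of \<open>g\<close> under the extremal two-point law,
    since \<open>g\<close> vanishes at \<open>ln z\<close>. The check clears the denominator
    \<open>v - z\<close> of \<open>pbound\<close>.\<close>
  also have "\<dots> = pbound \<mu> v * K"
  proof -
    have "(v - z) * (pbound \<mu> v * K) = (\<mu> - z) * K"
      unfolding pbound_def z_def[symmetric] using z \<mu> by simp
    also have "\<dots> = (\<mu> - z) * (v / z - 1) + ((\<mu> - z) * ln z - (\<mu> - z) * ln v)"
      unfolding K_def using z \<mu> by (simp add: ln_div algebra_simps)
    \<comment> \<open>The root equation replaces \<open>(\<mu> - z) * ln v\<close> by
      \<open>- (v - \<mu>) * ln z\<close>.\<close>
    also have "(\<mu> - z) * ln z - (\<mu> - z) * ln v = (v - z) * ln z"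
      using z(3) by (simp add: algebra_simps)
    also have "(\<mu> - z) * (v / z - 1) = (v - z) * (\<mu> / z - 1)"
      using z by (simp add: field_simps)
    finally have "(v - z) * (pbound \<mu> v * K) = (v - z) * (\<mu> / z - 1 + ln z)"
      by (simp add: algebra_simps)
    then show ?thesis using z \<mu> by simp
  qed
  finally have Eg: "expectation (\<lambda>\<omega>. g (W \<omega>)) / K \<le> pbound \<mu> v"
    using K_pos by (simp add: divide_le_eq)
  have [measurable]: "W \<in> borel_measurable M" using W by auto
  have "prob {\<omega> \<in> space M. exp (W \<omega>) \<ge> v} \<le> prob {\<omega> \<in> space M. g (W \<omega>) \<ge> K}"
    using g_ge unfolding g_def by (intro finite_measure_mono) auto
  also have "\<dots> \<le> expectation (\<lambda>\<omega>. g (W \<omega>)) / K"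
    using g_int g_nonneg K_pos by (intro integral_Markov_inequality_measure[where A = "{}"]) auto
  finally show ?thesis using Eg by simp
qed

text \<open>By independence the expectation of the product of exponentials factors, and the
  exponents of the individual bounds add up.\<close>

lemma (in prob_space) exp_sum_indep_subgaussian:
  fixes Y :: "'i \<Rightarrow> 'a \<Rightarrow> real"
  assumes "finite I"
    and indep: "indep_vars (\<lambda>_. borel) Y I"
    and int: "\<And>i. i \<in> I \<Longrightarrow> integrable M (\<lambda>\<omega>. exp (l * Y i \<omega>))"
    and bound: "\<And>i. i \<in> I \<Longrightarrow> expectation (\<lambda>\<omega>. exp (l * Y i \<omega>)) \<le> exp (l\<^sup>2 * (\<sigma> i)\<^sup>2 / 2)"
  shows "integrable M (\<lambda>\<omega>. exp (l * (\<Sum>i\<in>I. Y i \<omega>)))"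
    and "expectation (\<lambda>\<omega>. exp (l * (\<Sum>i\<in>I. Y i \<omega>))) \<le> exp (l\<^sup>2 * (\<Sum>i\<in>I. (\<sigma> i)\<^sup>2) / 2)"
proof -
  have eq: "(\<lambda>\<omega>. exp (l * (\<Sum>i\<in>I. Y i \<omega>))) = (\<lambda>\<omega>. \<Prod>i\<in>I. exp (l * Y i \<omega>))"
    using \<open>finite I\<close> by (simp add: sum_distrib_left exp_sum)
  have indep': "indep_vars (\<lambda>_. borel) (\<lambda>i \<omega>. exp (l * Y i \<omega>)) I"
    by (rule indep_vars_compose2[OF indep]) simp
  show "integrable M (\<lambda>\<omega>. exp (l * (\<Sum>i\<in>I. Y i \<omega>)))"
    unfolding eq by (intro indep_vars_integrable indep' int \<open>finite I\<close>)
  have "expectation (\<lambda>\<omega>. exp (l * (\<Sum>i\<in>I. Y i \<omega>))) = (\<Prod>i\<in>I. expectation (\<lambda>\<omega>. exp (l * Y i \<omega>)))"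
    unfolding eq by (intro indep_vars_lebesgue_integral indep' int \<open>finite I\<close>)
  also have "\<dots> \<le> (\<Prod>i\<in>I. exp (l\<^sup>2 * (\<sigma> i)\<^sup>2 / 2))"
    using bound by (intro prod_mono) auto
  also have "\<dots> = exp (l\<^sup>2 * (\<Sum>i\<in>I. (\<sigma> i)\<^sup>2) / 2)"
    using \<open>finite I\<close> by (simp add: sum_distrib_left sum_divide_distrib exp_sum)
  finally show "expectation (\<lambda>\<omega>. exp (l * (\<Sum>i\<in>I. Y i \<omega>))) \<le> exp (l\<^sup>2 * (\<Sum>i\<in>I. (\<sigma> i)\<^sup>2) / 2)" .
qed

theorem proposition3p1:
  fixes M :: "'a measure" and Y :: "nat \<Rightarrow> 'a \<Rightarrow> real"
    and \<sigma> :: "nat \<Rightarrow> real" and n :: nat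
    and \<sigma>\<^sub>Y y t \<mu>\<^sub>t v\<^sub>t :: real
  assumes "prob_space M"
    and "n \<ge> 1"
    and "prob_space.indep_vars M (\<lambda>_. borel) Y {1..n}"
    and "\<And>i. i \<in> {1..n} \<Longrightarrow> integrable M (Y i)"
    and "\<And>i. i \<in> {1..n} \<Longrightarrow> (\<integral>\<omega>. Y i \<omega> \<partial>M) = 0"
    and "\<And>i. i \<in> {1..n} \<Longrightarrow> \<sigma> i > 0"
    and "\<And>i l. i \<in> {1..n} \<Longrightarrow> l \<ge> 0 \<Longrightarrow> integrable M (\<lambda>\<omega>. exp (l * Y i \<omega>))"
    and "\<And>i l. i \<in> {1..n} \<Longrightarrow> l \<ge> 0 \<Longrightarrow>
           (\<integral>\<omega>. exp (l * Y i \<omega>) \<partial>M) \<le> exp (l\<^sup>2 * (\<sigma> i)\<^sup>2 / 2)"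
    and "\<sigma>\<^sub>Y = sqrt (\<Sum>i=1..n. (\<sigma> i)\<^sup>2)"
    and "y > 0"
    and "t = y / \<sigma>\<^sub>Y"
    and "\<mu>\<^sub>t = exp (t\<^sup>2 / 2)"
    and "v\<^sub>t = exp (t\<^sup>2)"
  shows "measure M {\<omega> \<in> space M. (\<Sum>i=1..n. Y i \<omega>) \<ge> y} \<le> pbound \<mu>\<^sub>t v\<^sub>t
    \<and> pbound \<mu>\<^sub>t v\<^sub>t = (\<mu>\<^sub>t - zroot \<mu>\<^sub>t v\<^sub>t) / (v\<^sub>t - zroot \<mu>\<^sub>t v\<^sub>t)
    \<and> (\<mu>\<^sub>t - zroot \<mu>\<^sub>t v\<^sub>t) / (v\<^sub>t - zroot \<mu>\<^sub>t v\<^sub>t) < \<mu>\<^sub>t / v\<^sub>t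
    \<and> \<mu>\<^sub>t / v\<^sub>t = exp (- (t\<^sup>2 / 2))"
proof -
  interpret prob_space M by fact
  have "(\<Sum>i=1..n. (\<sigma> i)\<^sup>2) > 0"
    using assms(2,6) by (intro sum_pos) fastforce+
  then have \<sigma>: "\<sigma>\<^sub>Y > 0" "\<sigma>\<^sub>Y\<^sup>2 = (\<Sum>i=1..n. (\<sigma> i)\<^sup>2)"
    unfolding assms(9) by simp_all
  have t: "t > 0" using \<sigma> assms(10,11) by simp
  have \<mu>: "1 < \<mu>\<^sub>t" "\<mu>\<^sub>t < v\<^sub>t" unfolding assms(12,13) using t by simp_all
  \<comment> \<open>This equals \<open>y / \<sigma>\<^sub>Y\<^sup>2\<close>, the minimiser of the
    Chernoff exponent \<open>l\<^sup>2 * \<sigma>\<^sub>Y\<^sup>2 / 2 - l * y\<close>. With it the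
    exponential moment bound becomes \<open>\<mu>\<^sub>t\<close> and the threshold
    \<open>exp (l * y)\<close> becomes \<open>v\<^sub>t\<close>.\<close>
  define l where "l = t / \<sigma>\<^sub>Y"
  have y: "y = t * \<sigma>\<^sub>Y" using assms(11) \<sigma>(1) by simp
  have l: "l > 0" "l * y = t\<^sup>2" "l\<^sup>2 * (\<Sum>i=1..n. (\<sigma> i)\<^sup>2) / 2 = t\<^sup>2 / 2"
    unfolding \<sigma>(2)[symmetric] l_def y using t \<sigma>(1) by (simp_all add: power2_eq_square)
  define W where "W = (\<lambda>\<omega>. l * (\<Sum>i=1..n. Y i \<omega>))"
  have l0: "l \<ge> 0" using l(1) by simp
  have W: "integrable M W" "expectation W = 0"
    unfolding W_def using assms(4,5) by (auto intro!: integrable_sum integrable_mult_right)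
  have "integrable M (\<lambda>\<omega>. exp (W \<omega>))" "expectation (\<lambda>\<omega>. exp (W \<omega>)) \<le> \<mu>\<^sub>t"
    using exp_sum_indep_subgaussian[OF finite_atLeastAtMost assms(3) assms(7)[OF _ l0] assms(8)[OF _ l0]]
    unfolding W_def assms(12) l(3) by blast+
  from prob_exp_ge_le_pbound[OF \<mu> W this]
  have "prob {\<omega> \<in> space M. exp (W \<omega>) \<ge> v\<^sub>t} \<le> pbound \<mu>\<^sub>t v\<^sub>t" .
  \<comment> \<open>Since \<open>l\<close> is positive, multiplying by it and exponentiating
    preserve the event.\<close>
  moreover have "exp (W \<omega>) \<ge> v\<^sub>t \<longleftrightarrow> (\<Sum>i=1..n. Y i \<omega>) \<ge> y" for \<omega>
    unfolding W_def assms(13) l(2)[symmetric] using l(1) by simp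
  moreover have "\<mu>\<^sub>t / v\<^sub>t = exp (- (t\<^sup>2 / 2))"
    unfolding assms(12,13) exp_diff[symmetric] by simp
  ultimately show ?thesis
    using pbound_less_ratio[OF \<mu>] by (simp add: pbound_def)
qed

end
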